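(* Let $d\ge2$ and let $(X_n)$ be a null recurrent rotor walk on $\mathbb{T}_d$, i.e. $\mathbb{E}[\rho(v)]=d-1$ and $r_{d-1}<1$, with i.i.d. random initial configuration. Let $\tau_0=0$ and $\tau_k=\inf\{n>\tau_{k-1}: X_n=o\}$ for $k\ge1$ (these are almost surely finite). Then $$\lim_{k\to\infty}\frac{|R_{\tau_k}|}{\tau_k}=\frac12\quad\text{almost surely}.$$
   Context: Fix an integer $d\ge2$. Let $\widetilde{\mathbb{T}}_d$ be the rooted tree with root $r$ in which every vertex has exactly $d$ children, and let $\mathbb{T}_d$ be $\widetilde{\mathbb{T}}_d$ together with an extra vertex $o$ (the sink) joined by an edge to $r$. For $v\in\widetilde{\mathbb{T}}_d$ its $d+1$ neighbours are labelled $v^{(0)},v^{(1)},\dots,v^{(d)}$, where $v^{(0)}$ is the parent of $v$ (with $r^{(0)}=o$) and $v^{(1)},\dots,v^{(d)}$ are the children of $v$ in a fixed order. A rotor configuration is a map $\rho:\widetilde{\mathbb{T}}_d\to\{0,1,\dots,d\}$. The rotor walk $(X_n)_{n\ge0}$ with initial configuration $\rho_0=\rho$ starts at $X_0=r$; if $X_n=v\in\widetilde{\mathbb{T}}_d$ then $\rho_{n+1}(v)=\rho_n(v)+1 \pmod{d+1}$, $\rho_{n+1}(u)=\rho_n(u)$ for $u\neq v$, and $X_{n+1}=v^{(\rho_{n+1}(v))}$; if $X_n=o$ then $X_{n+1}=r$ and the rotors are unchanged. The initial configuration is random: the $\rho(v)$, $v\in\widetilde{\mathbb{T}}_d$, are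 i.i.d. with $\mathbb{P}[\rho(v)=j]=r_j$ for $j=0,\dots,d$, $\sum_j r_j=1$. The range is $R_n=\{X_0,\dots,X_n\}\setminus\{o\}$ and $|R_n|$ is its cardinality. *)

theory Defs
  imports "HOL-Probability.Probability"
begin

text \<open>Vertices of the tree T_d: the sink o, or a vertex of the rooted d-ary tree,
  encoded as the list of child indices (each in 1..d) read from the vertex up to the
  root r = []. So child i of v is i # v and the parent of i # v is v.\<close>
datatype vtx = Sink | Node "nat list"

definition tree_vertices :: "nat \<Rightarrow> nat list set" where
  "tree_vertices d = {v. set v \<subseteq> {1..d}}"

definition nbr :: "nat list \<Rightarrow> nat \<Rightarrow> vtx" where
  "nbr v j = (if j = 0 then (if v = [] then Sink else Node (tl v)) else Node (j # v))"

fun rstep :: "nat \<Rightarrow> vtx \<times> (nat list \<Rightarrow> nat) \<Rightarrow> vtx \<times> (nat list \<Rightarrow> nat)" where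
  "rstep d (Sink, \<rho>) = (Node [], \<rho>)"
| "rstep d (Node v, \<rho>) =
     (let \<rho>' = \<rho>(v := (\<rho> v + 1) mod (d + 1)) in (nbr v (\<rho>' v), \<rho>'))"

definition rstate :: "nat \<Rightarrow> (nat list \<Rightarrow> nat) \<Rightarrow> nat \<Rightarrow> vtx \<times> (nat list \<Rightarrow> nat)" where
  "rstate d \<rho> n = (rstep d ^^ n) (Node [], \<rho>)"

definition rwalk :: "nat \<Rightarrow> (nat list \<Rightarrow> nat) \<Rightarrow> nat \<Rightarrow> vtx" where
  "rwalk d \<rho> n = fst (rstate d \<rho> n)"

definition rrange :: "nat \<Rightarrow> (nat list \<Rightarrow> nat) \<Rightarrow> nat \<Rightarrow> nat list set" where
  "rrange d \<rho> n = {v. \<exists>k\<le>n. rwalk d \<rho> k = Node v}"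

fun rtau :: "nat \<Rightarrow> (nat list \<Rightarrow> nat) \<Rightarrow> nat \<Rightarrow> nat" where
  "rtau d \<rho> 0 = 0"
| "rtau d \<rho> (Suc k) = (LEAST n. rtau d \<rho> k < n \<and> rwalk d \<rho> n = Sink)"

definition rotor_config_measure :: "nat \<Rightarrow> nat pmf \<Rightarrow> (nat list \<Rightarrow> nat) measure" where
  "rotor_config_measure d q = PiM (tree_vertices d) (\<lambda>_. measure_pmf q)"

end

theory Submission
  imports Defs
begin

text \<open>A child \<open>j\<close> of \<open>v\<close> is visited in the first excursion below \<open>v\<close> iff \<open>\<rho> v < j\<close>,
  so that excursion explores a critical Galton-Watson tree, which is almost surely finite.
  An excursion of the walk crosses every edge of the explored tree twice and leaves its rotors
  pointing to the parent. Hence the next excursion explores the old range together with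
  fresh critical trees rooted at its outer boundary, and \<open>\<tau>\<^sub>k\<close> is twice the sum of
  \<open>|R\<^bsub>\<tau>\<^sub>1\<^esub>|, \<dots>, |R\<^bsub>\<tau>\<^sub>k\<^esub>|\<close>, minus one. The boundary is larger than the range, which therefore at least
  doubles each time. Since a critical tree has infinite mean size, concentration for depth-truncated
  trees and Borel-Cantelli show that the range grows faster than every geometric sequence,
  so the last term dominates the sum.\<close>

section \<open>Excursions of the walk\<close>

text \<open>\<open>u @ v\<close> is reached from \<open>v\<close> before the walk leaves the subtree of \<open>v\<close> for the first time.\<close>

fun descends :: "nat \<Rightarrow> (nat list \<Rightarrow> nat) \<Rightarrow> nat list \<Rightarrow> nat list \<Rightarrow> bool" where
  "descends d \<sigma> v [] = True"
| "descends d \<sigma> v (j # u) = (descends d \<sigma> v u \<and> \<sigma> (u @ v) < j \<and> j \<le> d)"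

definition reach :: "nat \<Rightarrow> (nat list \<Rightarrow> nat) \<Rightarrow> nat list \<Rightarrow> nat list set" where
  "reach d \<sigma> v = {u @ v | u. descends d \<sigma> v u}"

text \<open>After a completed excursion the rotor of every visited vertex has turned round to 0, the
  direction of the parent.\<close>

definition clear :: "nat list set \<Rightarrow> (nat list \<Rightarrow> nat) \<Rightarrow> nat list \<Rightarrow> nat" where
  "clear A \<sigma> = (\<lambda>v. if v \<in> A then 0 else \<sigma> v)"

text \<open>Words grow at the head, away from \<open>v\<close>, whereas the walk branches at
  \<open>v\<close> first; this is the recursion from that end.\<close>

lemma descends_snoc:
  "descends d \<sigma> v (u @ [i]) \<longleftrightarrow> \<sigma> v < i \<and> i \<le> d \<and> descends d \<sigma> (i # v) u"
  by (induction u) auto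

lemma descends_cong:
  "(\<And>u. \<sigma> (u @ v) = \<sigma>' (u @ v)) \<Longrightarrow> descends d \<sigma> v u \<longleftrightarrow> descends d \<sigma>' v u"
  by (induction u) auto

lemma reach_cong: "(\<And>u. \<sigma> (u @ v) = \<sigma>' (u @ v)) \<Longrightarrow> reach d \<sigma> v = reach d \<sigma>' v"
  unfolding reach_def using descends_cong[of \<sigma> v \<sigma>'] by auto

lemma reach_append: "w \<in> reach d \<sigma> v \<Longrightarrow> \<exists>u. w = u @ v"
  by (auto simp: reach_def)

lemma self_in_reach [simp]: "v \<in> reach d \<sigma> v"
  unfolding reach_def by (intro CollectI exI[of _ "[]"]) auto

text \<open>Branching recursion: a rotor with \<open>\<sigma> v \<le> d\<close> passes through
  \<open>\<sigma> v + 1\<close> to \<open>d\<close> before it turns to the parent.\<close>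

lemma reach_unfold: "reach d \<sigma> v = insert v (\<Union>i\<in>{\<sigma> v<..d}. reach d \<sigma> (i # v))"
proof (intro equalityI subsetI)
  fix w assume "w \<in> reach d \<sigma> v"
  then obtain u where u: "w = u @ v" "descends d \<sigma> v u" by (auto simp: reach_def)
  show "w \<in> insert v (\<Union>i\<in>{\<sigma> v<..d}. reach d \<sigma> (i # v))"
  proof (cases u rule: rev_cases)
    case (snoc u' i)
    then show ?thesis using u by (auto simp: reach_def descends_snoc)
  qed (use u in auto)
next
  fix w assume "w \<in> insert v (\<Union>i\<in>{\<sigma> v<..d}. reach d \<sigma> (i # v))"
  then consider "w = v" | i u where "\<sigma> v < i" "i \<le> d" "w = u @ i # v" "descends d \<sigma> (i # v) u"
    by (auto simp: reach_def)
  then show "w \<in> reach d \<sigma> v"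
  proof cases
    case 2
    then show ?thesis unfolding reach_def
      by (intro CollectI exI[of _ "u @ [i]"]) (auto simp: descends_snoc)
  qed auto
qed

lemma append_Cons_eq_iff: "u @ i # v = u' @ i' # v \<longleftrightarrow> u = u' \<and> i = i'"
  using append_eq_append_conv[of "[i]" "[i']" u u'] by auto

text \<open>Decomposition behind the excursion induction: \<open>\<sigma>1\<close> is the
  configuration after the step to the child \<open>j\<close>, and \<open>\<sigma>2\<close> the one
  after the excursion below \<open>j\<close> has returned to \<open>v\<close>. Disjointness makes
  the two sizes add up.\<close>

lemma reach_after_child:
  assumes "\<sigma> v < d"
  defines "j \<equiv> Suc (\<sigma> v)"
  defines "\<sigma>1 \<equiv> \<sigma>(v := j)"
  defines "\<sigma>2 \<equiv> clear (reach d \<sigma>1 (j # v)) \<sigma>1"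
  shows "reach d \<sigma>1 (j # v) = reach d \<sigma> (j # v)"
    and "reach d \<sigma> v = reach d \<sigma>2 v \<union> reach d \<sigma> (j # v)"
    and "reach d \<sigma>2 v \<inter> reach d \<sigma> (j # v) = {}"
proof -
  have "v \<noteq> u @ i # v" for u i
  proof
    assume "v = u @ i # v"
    then have "length v = length (u @ i # v)" by metis
    then show False by simp
  qed
  note ne = this this[symmetric]
  show 1: "reach d \<sigma>1 (j # v) = reach d \<sigma> (j # v)"
    by (rule reach_cong) (simp add: \<sigma>1_def ne)
  have "v \<notin> reach d \<sigma> (j # v)"
    using ne by (auto dest!: reach_append)
  then have \<sigma>2v: "\<sigma>2 v = j"
    by (simp add: \<sigma>2_def clear_def 1) (simp add: \<sigma>1_def)
  have off: "u @ i # v \<notin> reach d \<sigma> (j # v)" if "i \<noteq> j" for i u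
    using that by (auto dest!: reach_append simp: append_Cons_eq_iff)
  have child: "reach d \<sigma>2 (i # v) = reach d \<sigma> (i # v)" if "i \<noteq> j" for i
    by (rule reach_cong) (simp add: \<sigma>2_def clear_def 1 off[OF that], simp add: \<sigma>1_def ne)
  have 2: "reach d \<sigma>2 v = insert v (\<Union>i\<in>{j<..d}. reach d \<sigma> (i # v))"
    unfolding reach_unfold[of d \<sigma>2 v] \<sigma>2v using child by auto
  have "{\<sigma> v<..d} = insert j {j<..d}"
    using assms(1) by (auto simp: j_def)
  then show "reach d \<sigma> v = reach d \<sigma>2 v \<union> reach d \<sigma> (j # v)"
    unfolding reach_unfold[of d \<sigma> v] 2 by auto
  have "w \<notin> reach d \<sigma> (i # v)" if "j < i" "w \<in> reach d \<sigma> (j # v)" for i w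
    using that by (auto dest!: reach_append simp: append_Cons_eq_iff)
  then show "reach d \<sigma>2 v \<inter> reach d \<sigma> (j # v) = {}"
    unfolding 2 using \<open>v \<notin> _\<close> by auto
qed

text \<open>The length counts both crossings of each of the
  \<open>card (reach d \<sigma> v) - 1\<close> edges of the explored tree, plus the final step to
  the parent.\<close>

definition excursion :: "nat \<Rightarrow> (nat list \<Rightarrow> nat) \<Rightarrow> nat list \<Rightarrow> bool" where
  "excursion d \<sigma> v \<longleftrightarrow>
     (rstep d ^^ (2 * card (reach d \<sigma> v) - 1)) (Node v, \<sigma>) = (nbr v 0, clear (reach d \<sigma> v) \<sigma>) \<and>
     (\<lambda>i. fst ((rstep d ^^ i) (Node v, \<sigma>))) ` {..<2 * card (reach d \<sigma> v) - 1} = Node ` reach d \<sigma> v"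

lemma funpow_add_apply: "(f ^^ (m + n)) x = (f ^^ n) ((f ^^ m) x)"
  by (subst add.commute) (simp add: funpow_add)

lemma image_funpow_add:
  "(\<lambda>i. g ((f ^^ i) x)) ` {..<m + n} =
     (\<lambda>i. g ((f ^^ i) x)) ` {..<m} \<union> (\<lambda>i. g ((f ^^ i) ((f ^^ m) x))) ` {..<n}"
proof -
  have "{..<m + n} = {..<m} \<union> (\<lambda>i. m + i) ` {..<n}"
    using ivl_disj_un_one(2)[of m "m + n"] image_add_atLeastLessThan[of m 0 n]
    by (simp add: lessThan_atLeast0 add.commute)
  then show ?thesis by (simp add: image_Un image_image funpow_add_apply)
qed

text \<open>Induction on the number of reached vertices: a step to the first child, the excursion
  below it, then an excursion from \<open>v\<close> with its rotor advanced. Both of these reach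
  fewer vertices.\<close>

lemma excursionI:
  assumes "finite (reach d \<sigma> v)" "\<And>w. w \<in> reach d \<sigma> v \<Longrightarrow> \<sigma> w \<le> d"
  shows "excursion d \<sigma> v"
  using assms
proof (induction "card (reach d \<sigma> v)" arbitrary: \<sigma> v rule: less_induct)
  case less
  have "\<sigma> v \<le> d" using less.prems(2) by simp
  then consider "\<sigma> v = d" | "\<sigma> v < d" by linarith
  then show ?case
  proof cases
    case 1
    have "reach d \<sigma> v = {v}"
      unfolding reach_unfold[of d \<sigma> v] 1 by simp
    moreover have "rstep d (Node v, \<sigma>) = (nbr v 0, clear {v} \<sigma>)"
      by (simp add: 1 Let_def clear_def fun_eq_iff)
    ultimately show ?thesis
      by (simp add: excursion_def lessThan_Suc del: rstep.simps)
  next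
    case 2
    define j where "j = Suc (\<sigma> v)"
    define \<sigma>1 where "\<sigma>1 = \<sigma>(v := j)"
    define \<sigma>2 where "\<sigma>2 = clear (reach d \<sigma>1 (j # v)) \<sigma>1"
    define a where "a = card (reach d \<sigma>1 (j # v))"
    define b where "b = card (reach d \<sigma>2 v)"
    note split = reach_after_child[where \<sigma> = \<sigma>, OF 2, folded j_def, folded \<sigma>1_def, folded \<sigma>2_def]
    have fin: "finite (reach d \<sigma>1 (j # v))" "finite (reach d \<sigma>2 v)"
      using less.prems(1) unfolding split(1) split(2) by auto
    have "a > 0" "b > 0"
      unfolding a_def b_def using fin self_in_reach by (metis card_gt_0_iff empty_iff)+
    have card: "card (reach d \<sigma> v) = a + b"
      unfolding a_def b_def split(1) split(2) using fin split(3) unfolding split(1)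
      by (subst card_Un_disjoint) auto
    have first: "rstep d (Node v, \<sigma>) = (Node (j # v), \<sigma>1)"
      using 2 by (simp add: j_def \<sigma>1_def Let_def nbr_def)
    then have first1: "(rstep d ^^ 1) (Node v, \<sigma>) = (Node (j # v), \<sigma>1)"
      by (simp del: rstep.simps)
    have "\<sigma>1 w \<le> d" if "w \<in> reach d \<sigma>1 (j # v)" for w
      using that less.prems(2)[of w] 2 split(2) unfolding split(1) by (auto simp: \<sigma>1_def j_def)
    moreover have "a < card (reach d \<sigma> v)" using card \<open>b > 0\<close> by simp
    ultimately have ex1: "excursion d \<sigma>1 (j # v)"
      using less.hyps fin(1) unfolding a_def by blast
    have "\<sigma>2 w \<le> d" if "w \<in> reach d \<sigma>2 v" for w
      using that less.prems(2)[of w] 2 split(2) by (auto simp: \<sigma>2_def \<sigma>1_def clear_def j_def)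
    moreover have "b < card (reach d \<sigma> v)" using card \<open>a > 0\<close> by simp
    ultimately have ex2: "excursion d \<sigma>2 v"
      using less.hyps fin(2) unfolding b_def by blast
    have steps: "2 * card (reach d \<sigma> v) - 1 = 1 + ((2 * a - 1) + (2 * b - 1))"
      unfolding card using \<open>a > 0\<close> \<open>b > 0\<close> by simp
    have ret: "(rstep d ^^ (2 * a - 1)) (Node (j # v), \<sigma>1) = (Node v, \<sigma>2)"
      using ex1 by (simp add: excursion_def a_def \<sigma>2_def nbr_def)
    have vis1: "(\<lambda>i. fst ((rstep d ^^ i) (Node (j # v), \<sigma>1))) ` {..<2 * a - 1} = Node ` reach d \<sigma> (j # v)"
      using ex1 by (simp add: excursion_def a_def split(1))
    \<comment> \<open>Vertices below \<open>j # v\<close> are already at 0 in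
      \<open>\<sigma>2\<close>, and the advanced rotor at \<open>v\<close> is reset by the second
      excursion.\<close>
    have clear: "clear (reach d \<sigma>2 v) \<sigma>2 = clear (reach d \<sigma> v) \<sigma>"
    proof
      fix w
      have "\<sigma>2 w = (if w \<in> reach d \<sigma> (j # v) then 0 else \<sigma>1 w)"
        by (simp add: \<sigma>2_def clear_def split(1))
      then show "clear (reach d \<sigma>2 v) \<sigma>2 w = clear (reach d \<sigma> v) \<sigma> w"
        by (simp add: clear_def split(2) \<sigma>1_def)
    qed
    have "(rstep d ^^ (2 * card (reach d \<sigma> v) - 1)) (Node v, \<sigma>) = (rstep d ^^ (2 * b - 1)) (Node v, \<sigma>2)"
      unfolding steps funpow_add_apply by (simp only: first1 ret)
    also have "\<dots> = (nbr v 0, clear (reach d \<sigma> v) \<sigma>)"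
      using ex2 by (simp add: excursion_def b_def clear)
    finally have end_state: "(rstep d ^^ (2 * card (reach d \<sigma> v) - 1)) (Node v, \<sigma>) = (nbr v 0, clear (reach d \<sigma> v) \<sigma>)" .
    have "(\<lambda>i. fst ((rstep d ^^ i) (Node v, \<sigma>))) ` {..<2 * card (reach d \<sigma> v) - 1}
       = insert (Node v) (Node ` reach d \<sigma> (j # v) \<union> Node ` reach d \<sigma>2 v)"
      unfolding steps image_funpow_add[where g = fst] first1 ret vis1
      using ex2 by (simp add: lessThan_Suc excursion_def b_def)
    also have "\<dots> = Node ` reach d \<sigma> v"
      by (auto simp: split(2))
    finally show ?thesis using end_state by (simp add: excursion_def)
  qed
qed

section \<open>Explored sets and their outer boundaries\<close>

text \<open>The toll of \<open>v\<close> is the number of excursions that end before the first one that visits \<open>v\<close>.\<close>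

fun toll :: "(nat list \<Rightarrow> nat) \<Rightarrow> nat list \<Rightarrow> nat" where
  "toll \<rho> [] = 0"
| "toll \<rho> (j # v) = toll \<rho> v + (if j \<le> \<rho> v then 1 else 0)"

text \<open>Describes the range after \<open>k > 0\<close> excursions without mentioning the walk;
  \<open>rrange_rtau\<close> identifies the two.\<close>

definition explored :: "nat \<Rightarrow> (nat list \<Rightarrow> nat) \<Rightarrow> nat \<Rightarrow> nat list set" where
  "explored d \<rho> k = {v \<in> tree_vertices d. toll \<rho> v < k}"

text \<open>The clause for \<open>[]\<close> makes the root the boundary of the empty set, so the
  first excursion needs no special treatment.\<close>

definition fringe :: "nat \<Rightarrow> nat list set \<Rightarrow> nat list set" where
  "fringe d A = {v \<in> tree_vertices d. v \<notin> A \<and> (v = [] \<or> tl v \<in> A)}"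

lemma Nil_tree_vertices [simp]: "[] \<in> tree_vertices d"
  by (simp add: tree_vertices_def)

lemma Cons_tree_vertices [simp]:
  "j # v \<in> tree_vertices d \<longleftrightarrow> 1 \<le> j \<and> j \<le> d \<and> v \<in> tree_vertices d"
  by (auto simp: tree_vertices_def)

lemma append_tree_vertices [simp]:
  "u @ v \<in> tree_vertices d \<longleftrightarrow> u \<in> tree_vertices d \<and> v \<in> tree_vertices d"
  by (auto simp: tree_vertices_def)

lemma descends_tree: "descends d \<sigma> v u \<Longrightarrow> u \<in> tree_vertices d"
  by (induction u) auto

lemma reach_subset_tree: "v \<in> tree_vertices d \<Longrightarrow> reach d \<sigma> v \<subseteq> tree_vertices d"
  unfolding reach_def using descends_tree by fastforce

lemma explored_subset_tree: "explored d \<rho> k \<subseteq> tree_vertices d"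
  by (auto simp: explored_def)

lemma explored_0 [simp]: "explored d \<rho> 0 = {}"
  by (simp add: explored_def)

lemma Nil_explored [simp]: "[] \<in> explored d \<rho> (Suc k)"
  by (simp add: explored_def)

lemma explored_mono: "i \<le> k \<Longrightarrow> explored d \<rho> i \<subseteq> explored d \<rho> k"
  by (auto simp: explored_def)

lemma explored_Cons: "j # v \<in> explored d \<rho> k \<Longrightarrow> v \<in> explored d \<rho> k"
  by (auto simp: explored_def)

lemma explored_append: "u @ v \<in> explored d \<rho> k \<Longrightarrow> v \<in> explored d \<rho> k"
  by (induction u) (auto dest: explored_Cons)

text \<open>A cleared rotor opens all children of an explored vertex, and their toll is still at
  most \<open>k\<close>. At a vertex of toll \<open>k\<close> the original rotor decides which
  children keep that toll.\<close>

lemma reach_clear_explored: "reach d (clear (explored d \<rho> k) \<rho>) [] = explored d \<rho> (Suc k)"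
proof -
  have "descends d (clear (explored d \<rho> k) \<rho>) [] v \<longleftrightarrow> v \<in> explored d \<rho> (Suc k)" for v
  proof (induction v)
    case (Cons j v)
    then show ?case
      by (auto simp: clear_def explored_def)
  qed (simp add: explored_def)
  then show ?thesis by (auto simp: reach_def)
qed

text \<open>A vertex of toll exactly \<open>k\<close> hangs below its topmost ancestor of toll
  \<open>k\<close>. That ancestor lies on the fringe, and the path down from it obeys the untouched
  rotors.\<close>

lemma explored_Suc:
  "explored d \<rho> (Suc k) = explored d \<rho> k \<union> (\<Union>v\<in>fringe d (explored d \<rho> k). reach d \<rho> v)"
proof -
  have "\<exists>v\<in>fringe d (explored d \<rho> k). w \<in> reach d \<rho> v"
    if "w \<in> tree_vertices d" "toll \<rho> w = k" for w
    using that
  proof (induction w)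
    case (Cons j w)
    show ?case
    proof (cases "toll \<rho> w < k")
      case True
      then have "j # w \<in> fringe d (explored d \<rho> k)"
        using Cons.prems by (auto simp: fringe_def explored_def)
      then show ?thesis by (meson self_in_reach)
    next
      case False
      then have "toll \<rho> w = k" "\<rho> w < j" using Cons.prems by (auto split: if_splits)
      moreover have "w \<in> tree_vertices d" "j \<le> d" using Cons.prems(1) by simp_all
      ultimately obtain v u where vu: "v \<in> fringe d (explored d \<rho> k)" "w = u @ v" "descends d \<rho> v u"
        using Cons.IH unfolding reach_def by blast
      then have "j # w \<in> reach d \<rho> v" using \<open>\<rho> w < j\<close> \<open>j \<le> d\<close>
        unfolding reach_def by (intro CollectI exI[of _ "j # u"]) simp
      then show ?thesis using vu(1) by blast
    qed
  qed (auto simp: fringe_def explored_def intro!: bexI[of _ "[]"])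
  then have "explored d \<rho> (Suc k) \<subseteq> explored d \<rho> k \<union> (\<Union>v\<in>fringe d (explored d \<rho> k). reach d \<rho> v)"
    by (auto simp: explored_def less_Suc_eq)
  moreover have "reach d \<rho> v \<subseteq> explored d \<rho> (Suc k)" if v: "v \<in> fringe d (explored d \<rho> k)" for v
  proof -
    have "toll \<rho> v = k"
      using v by (cases v) (auto simp: fringe_def explored_def split: if_splits)
    moreover have "descends d \<rho> v u \<Longrightarrow> toll \<rho> (u @ v) = toll \<rho> v" for u
      by (induction u) auto
    moreover have "v \<in> tree_vertices d" using v by (simp add: fringe_def)
    ultimately show ?thesis
      using reach_subset_tree[of v d \<rho>] by (auto simp: explored_def reach_def)
  qed
  ultimately show ?thesis
    by (intro equalityI Un_least UN_least explored_mono) auto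
qed

lemma finite_fringe: "finite A \<Longrightarrow> finite (fringe d A)"
proof -
  assume "finite A"
  have "fringe d A \<subseteq> insert [] ((\<lambda>(j, v). j # v) ` ({1..d} \<times> A))"
  proof
    fix w assume "w \<in> fringe d A"
    then show "w \<in> insert [] ((\<lambda>(j, v). j # v) ` ({1..d} \<times> A))"
      by (cases w) (auto simp: fringe_def)
  qed
  then show ?thesis
    by (rule finite_subset) (use \<open>finite A\<close> in auto)
qed

text \<open>The \<open>d * card A\<close> children of \<open>A\<close> and the root all lie in
  \<open>A\<close> or on its fringe.\<close>

lemma card_fringe_ge:
  assumes "finite A" "A \<subseteq> tree_vertices d" "d \<ge> 2"
  shows "card A < card (fringe d A)"
proof -
  have "(\<lambda>(j, v). j # v) ` ({1..d} \<times> A) \<union> {[]} \<subseteq> A \<union> fringe d A"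
    using assms(2) by (auto simp: fringe_def)
  then have "card ((\<lambda>(j, v). j # v) ` ({1..d} \<times> A) \<union> {[]}) \<le> card (A \<union> fringe d A)"
    by (rule card_mono[rotated]) (simp add: assms(1) finite_fringe)
  also have "\<dots> \<le> card A + card (fringe d A)" by (rule card_Un_le)
  also have "card ((\<lambda>(j, v). j # v) ` ({1..d} \<times> A) \<union> {[]}) = d * card A + 1"
    using assms(1) by (subst card_Un_disjoint) (auto simp: card_image inj_on_def card_cartesian_product)
  finally have "d * card A + 1 \<le> card A + card (fringe d A)" .
  moreover have "2 * card A \<le> d * card A" using assms(3) by simp
  ultimately show ?thesis by linarith
qed

text \<open>The fringe is an antichain: a proper ancestor of a fringe vertex is an ancestor of its
  explored parent, hence explored itself.\<close>

lemma fringe_suffix: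
  assumes "v \<in> fringe d (explored d \<rho> k)" "v' \<in> fringe d (explored d \<rho> k)" "u @ v = u' @ v'"
  shows "v = v'"
proof -
  have *: False if "v \<in> fringe d (explored d \<rho> k)" "v' \<in> fringe d (explored d \<rho> k)"
    "v' = (i # u) @ v" for v v' i u
    using that explored_append[of u v d \<rho> k] by (auto simp: fringe_def)
  obtain us where "v = us @ v' \<or> v' = us @ v"
    using assms(3) by (auto simp: append_eq_append_conv2)
  then show ?thesis using *[of v v'] *[of v' v] assms by (cases us) auto
qed

lemma card_explored_Suc:
  assumes "finite (explored d \<rho> k)" "\<And>v. v \<in> tree_vertices d \<Longrightarrow> finite (reach d \<rho> v)"
  shows "card (explored d \<rho> (Suc k)) =
    card (explored d \<rho> k) + (\<Sum>v\<in>fringe d (explored d \<rho> k). card (reach d \<rho> v))"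
proof -
  let ?A = "explored d \<rho> k"
  have fin: "finite (reach d \<rho> v)" if "v \<in> fringe d ?A" for v
    using that assms(2) by (simp add: fringe_def)
  have "?A \<inter> reach d \<rho> v = {}" if "v \<in> fringe d ?A" for v
    using that explored_append by (fastforce simp: fringe_def reach_def)
  then have "card (explored d \<rho> (Suc k)) = card ?A + card (\<Union>v\<in>fringe d ?A. reach d \<rho> v)"
    unfolding explored_Suc using assms(1) fin finite_fringe[OF assms(1)]
    by (intro card_Un_disjoint) auto
  also have "card (\<Union>v\<in>fringe d ?A. reach d \<rho> v) = (\<Sum>v\<in>fringe d ?A. card (reach d \<rho> v))"
    using assms(1) fin
    by (intro card_UN_disjoint ballI finite_fringe impI)
       (auto simp: reach_def dest: fringe_suffix)
  finally show ?thesis .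
qed

lemma finite_explored:
  assumes "\<And>v. v \<in> tree_vertices d \<Longrightarrow> finite (reach d \<rho> v)"
  shows "finite (explored d \<rho> k)"
proof (induction k)
  case (Suc k)
  have "finite (reach d \<rho> v)" if "v \<in> fringe d (explored d \<rho> k)" for v
    using that assms by (simp add: fringe_def)
  then show ?case using Suc by (simp add: explored_Suc finite_fringe)
qed simp

lemma toll_local:
  assumes "\<And>v. v \<in> explored d \<rho> k \<Longrightarrow> \<rho> v = \<rho>' v" "v \<in> tree_vertices d"
  shows "toll \<rho> v < k \<or> toll \<rho>' v < k \<Longrightarrow> toll \<rho> v = toll \<rho>' v"
  using assms(2)
proof (induction v)
  case (Cons j v)
  then have "toll \<rho> v = toll \<rho>' v" "toll \<rho> v < k" by (auto split: if_splits)
  moreover from this have "\<rho> v = \<rho>' v" using Cons.prems assms(1) by (auto simp: explored_def)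
  ultimately show ?case by simp
qed simp

text \<open>Stopping property: whether the explored set equals a given set is decided by the rotors
  inside that set. This leaves the rotors below the fringe fresh.\<close>

lemma explored_local:
  assumes "\<And>v. v \<in> explored d \<rho> k \<Longrightarrow> \<rho> v = \<rho>' v"
  shows "explored d \<rho>' k = explored d \<rho> k"
proof -
  have "toll \<rho>' v < k \<longleftrightarrow> toll \<rho> v < k" if "v \<in> tree_vertices d" for v
    using toll_local[of d \<rho> k \<rho>' v] assms that by metis
  then show ?thesis unfolding explored_def by blast
qed

section \<open>Return times and range expressed by explored sets\<close>

locale finite_excursions =
  fixes d :: nat and \<rho> :: "nat list \<Rightarrow> nat"
  assumes d: "d \<ge> 2"
    and rotor_le: "\<And>v. v \<in> tree_vertices d \<Longrightarrow> \<rho> v \<le> d"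
    and fin_reach: "\<And>v. v \<in> tree_vertices d \<Longrightarrow> finite (reach d \<rho> v)"
begin

abbreviation "E \<equiv> explored d \<rho>"

text \<open>Excursion \<open>k + 1\<close> starts at the root at time \<open>restart k\<close>; the truncated \<open>restart 0 - 1 = 0\<close>
  agrees with the convention \<open>\<tau>\<^sub>0 = 0\<close>.\<close>

definition restart :: "nat \<Rightarrow> nat" where
  "restart k = 2 * (\<Sum>i=1..k. card (E i))"

lemma finE: "finite (E k)"
  using finite_explored fin_reach by blast

lemma restart_Suc: "restart (Suc k) = restart k + 2 * card (E (Suc k))"
  by (simp add: restart_def)

lemma card_E_pos: "card (E (Suc k)) > 0"
  using finE Nil_explored by (metis card_gt_0_iff empty_iff)

lemma excursion_explored: "excursion d (clear (E k) \<rho>) []"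
proof (rule excursionI)
  show "finite (reach d (clear (E k) \<rho>) [])" by (simp add: reach_clear_explored finE)
  fix w assume "w \<in> reach d (clear (E k) \<rho>) []"
  then show "clear (E k) \<rho> w \<le> d"
    using rotor_le reach_subset_tree[OF Nil_tree_vertices] by (force simp: clear_def)
qed

lemma clear_clear_explored: "clear (E (Suc k)) (clear (E k) \<rho>) = clear (E (Suc k)) \<rho>"
  using explored_mono[of k "Suc k" d \<rho>] by (auto simp: clear_def fun_eq_iff)

lemma rstate_add: "rstate d \<rho> (m + n) = (rstep d ^^ n) (rstate d \<rho> m)"
  by (simp add: rstate_def funpow_add_apply)

text \<open>The walk is at the sink one step before it restarts at the root, hence the
  \<open>- 1\<close>. The hypothesis is kept explicit because its inductive proof in
  \<open>rstate_restart\<close> uses the first conclusion.\<close>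

lemma rstate_return_aux:
  assumes "rstate d \<rho> (restart k) = (Node [], clear (E k) \<rho>)"
  shows "rstate d \<rho> (restart (Suc k) - 1) = (Sink, clear (E (Suc k)) \<rho>)"
    and "rwalk d \<rho> ` {restart k..<restart (Suc k) - 1} = Node ` E (Suc k)"
proof -
  let ?n = "2 * card (E (Suc k)) - 1"
  have n: "restart (Suc k) - 1 = restart k + ?n"
    using card_E_pos[of k] by (simp add: restart_Suc)
  note ex = excursion_explored[of k, unfolded excursion_def reach_clear_explored]
  show "rstate d \<rho> (restart (Suc k) - 1) = (Sink, clear (E (Suc k)) \<rho>)"
    unfolding n rstate_add assms using ex by (simp add: clear_clear_explored nbr_def)
  have "rwalk d \<rho> ` {restart k..<restart k + ?n} = (\<lambda>i. rwalk d \<rho> (restart k + i)) ` {..<?n}"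
    using image_add_atLeastLessThan[of "restart k" 0 ?n]
    by (simp only: image_image[symmetric, of "rwalk d \<rho>" "\<lambda>i. restart k + i"] lessThan_atLeast0 add_0_right add.commute[of _ "restart k"])
  then show "rwalk d \<rho> ` {restart k..<restart (Suc k) - 1} = Node ` E (Suc k)"
    unfolding n using ex by (simp add: rwalk_def rstate_add assms)
qed

lemma rstate_restart: "rstate d \<rho> (restart k) = (Node [], clear (E k) \<rho>)"
proof (induction k)
  case 0
  show ?case by (simp add: restart_def rstate_def clear_def)
next
  case (Suc k)
  have "restart (Suc k) = (restart (Suc k) - 1) + 1"
    using card_E_pos[of k] by (simp add: restart_Suc)
  then have "rstate d \<rho> (restart (Suc k)) = rstep d (rstate d \<rho> (restart (Suc k) - 1))"
    using rstate_add[of "restart (Suc k) - 1" 1] by simp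
  then show ?case using rstate_return_aux(1)[OF Suc.IH] by simp
qed

lemmas rstate_return = rstate_return_aux(1)[OF rstate_restart]
  and rwalk_excursion = rstate_return_aux(2)[OF rstate_restart]

lemma rwalk_return: "rwalk d \<rho> (restart (Suc k) - 1) = Sink"
  unfolding rwalk_def rstate_return by simp

lemma rwalk_not_sink: "restart k \<le> n \<Longrightarrow> n < restart (Suc k) - 1 \<Longrightarrow> rwalk d \<rho> n \<noteq> Sink"
  using rwalk_excursion[of k] by (metis atLeastLessThan_iff imageE image_eqI vtx.distinct(1))

lemma restart_less: "restart k - 1 < restart (Suc k) - 1"
  using card_E_pos[of k] by (cases "restart k") (auto simp: restart_Suc)

lemma rtau_eq: "rtau d \<rho> k = restart k - 1"
proof (induction k)
  case 0
  show ?case by (simp add: restart_def)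
next
  case (Suc k)
  have "restart (Suc k) - 1 \<le> n" if "restart k - 1 < n" "rwalk d \<rho> n = Sink" for n
    using rwalk_not_sink[of k n] that by force
  then show ?case
    using restart_less rwalk_return by (simp add: Suc) (intro Least_equality; simp)
qed

lemma return_again: "\<exists>n > rtau d \<rho> k. rwalk d \<rho> n = Sink"
  using restart_less rwalk_return unfolding rtau_eq by blast

lemma rwalk_before_return: "rwalk d \<rho> ` {..restart (Suc k) - 1} = insert Sink (Node ` E (Suc k))"
proof (induction k)
  case 0
  have "{..restart (Suc 0) - 1} = insert (restart (Suc 0) - 1) {restart 0..<restart (Suc 0) - 1}"
    by (auto simp: restart_def)
  then show ?case using rwalk_excursion[of 0] rwalk_return[of 0] by simp
next
  case (Suc k)
  have "{..restart (Suc (Suc k)) - 1} = insert (restart (Suc (Suc k)) - 1)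
     ({..restart (Suc k) - 1} \<union> {restart (Suc k)..<restart (Suc (Suc k)) - 1})"
    using card_E_pos[of k] by (auto simp: restart_Suc)
  then show ?case
    using rwalk_excursion[of "Suc k"] rwalk_return[of "Suc k"] explored_mono[of "Suc k" "Suc (Suc k)" d \<rho>] Suc
    by (simp add: image_Un) auto
qed

lemma rrange_rtau: "rrange d \<rho> (rtau d \<rho> (Suc k)) = E (Suc k)"
proof -
  have "v \<in> rrange d \<rho> (rtau d \<rho> (Suc k)) \<longleftrightarrow> Node v \<in> rwalk d \<rho> ` {..restart (Suc k) - 1}" for v
    unfolding rrange_def rtau_eq by force
  then show ?thesis unfolding rwalk_before_return by auto
qed

lemma card_reach_pos: "v \<in> tree_vertices d \<Longrightarrow> card (reach d \<rho> v) \<ge> 1"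
  using fin_reach[of v] self_in_reach[of v d \<rho>]
  by (metis One_nat_def Suc_leI card_gt_0_iff empty_iff)

lemma card_E_double: "2 * card (E k) \<le> card (E (Suc k))"
proof -
  have "card (fringe d (E k)) \<le> (\<Sum>v\<in>fringe d (E k). card (reach d \<rho> v))"
    using sum_bounded_below[of "fringe d (E k)" 1 "\<lambda>v. card (reach d \<rho> v)"] card_reach_pos
    by (simp add: fringe_def)
  then show ?thesis
    using card_explored_Suc[OF finE fin_reach] card_fringe_ge[OF finE explored_subset_tree d, of k]
    by fastforce
qed

lemma card_E_ge: "k \<le> card (E k)"
proof (induction k)
  case (Suc k)
  then show ?case using card_E_double[of k] card_E_pos[of k] by linarith
qed simp

text \<open>By doubling, the sum of all ranges so far is at most twice the last one, as for a
  geometric series.\<close>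

lemma restart_le: "restart k \<le> 4 * card (E k)"
proof (induction k)
  case (Suc k)
  then show ?case using card_E_double[of k] by (simp add: restart_Suc)
qed (simp add: restart_def)

text \<open>Dividing \<open>restart k + 2 * x (Suc k) - 1\<close>, the return time, by the range
  \<open>x (Suc k)\<close> leaves 2 plus two terms that vanish under superexponential
  growth.\<close>

lemma ratio_limit:
  assumes "\<And>M. \<forall>\<^sub>F k in sequentially. real M * card (E k) \<le> card (E (Suc k))"
  shows "(\<lambda>k. real (card (rrange d \<rho> (rtau d \<rho> k))) / real (rtau d \<rho> k)) \<longlonglongrightarrow> 1 / 2"
proof -
  define x where "x k = real (card (E k))" for k
  have pos: "x (Suc k) \<ge> 1" for k using card_E_pos[of k] by (simp add: x_def)
  have "(\<lambda>k. 1 / x (Suc k)) \<longlonglongrightarrow> 0"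
  proof (rule tendsto_sandwich[OF _ _ tendsto_const LIMSEQ_inverse_real_of_nat])
    show "\<forall>\<^sub>F k in sequentially. 1 / x (Suc k) \<le> inverse (real (Suc k))"
    proof (intro always_eventually allI)
      fix k
      have "real (Suc k) \<le> x (Suc k)"
        using card_E_ge[of "Suc k"] by (simp only: x_def of_nat_le_iff)
      then show "1 / x (Suc k) \<le> inverse (real (Suc k))"
        using pos[of k] by (simp add: divide_simps)
    qed
  qed (use pos in \<open>auto simp: x_def\<close>)
  moreover have "(\<lambda>k. restart k / x (Suc k)) \<longlonglongrightarrow> 0"
  proof (rule LIMSEQ_I)
    fix e :: real assume "e > 0"
    obtain M :: nat where M: "real M > 4 / e" using reals_Archimedean2 by blast
    have "\<forall>\<^sub>F k in sequentially. norm (restart k / x (Suc k) - 0) < e"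
      using assms[of M]
    proof eventually_elim
      case (elim k)
      have "real (restart k) \<le> 4 * x k" using restart_le[of k] by (simp add: x_def)
      moreover have "4 * x k \<le> (e * M) * x k"
        using M \<open>e > 0\<close> by (intro mult_right_mono) (auto simp: x_def field_simps)
      moreover have "e * (M * x k) \<le> e * x (Suc k)"
        using elim \<open>e > 0\<close> by (simp add: x_def)
      moreover have "real (restart k) < e * x (Suc k)"
      proof (cases "x k = 0")
        case True
        then show ?thesis using calculation(1) \<open>e > 0\<close> pos[of k] by (smt (verit) mult_pos_pos)
      next
        case False
        then have "4 * x k < (e * M) * x k"
          using M \<open>e > 0\<close> by (intro mult_strict_right_mono) (auto simp: x_def field_simps)
        then show ?thesis using calculation by (simp add: mult.assoc)
      qed
      ultimately show ?case using pos[of k] by (simp add: divide_simps)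
    qed
    then show "\<exists>no. \<forall>n\<ge>no. norm (restart n / x (Suc n) - 0) < e"
      by (simp add: eventually_sequentially)
  qed
  ultimately have "(\<lambda>k. 1 / (2 + restart k / x (Suc k) - 1 / x (Suc k))) \<longlonglongrightarrow> 1 / (2 + 0 - 0)"
    by (intro tendsto_intros) auto
  moreover have "real (card (rrange d \<rho> (rtau d \<rho> (Suc k)))) / real (rtau d \<rho> (Suc k))
       = 1 / (2 + restart k / x (Suc k) - 1 / x (Suc k))" for k
  proof -
    have "real (rtau d \<rho> (Suc k)) = restart k + 2 * x (Suc k) - 1"
      using card_E_pos[of k] unfolding rtau_eq by (simp add: restart_Suc x_def of_nat_diff)
    also have "\<dots> = x (Suc k) * (2 + restart k / x (Suc k) - 1 / x (Suc k))"
      using pos[of k] by (simp add: field_simps)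
    finally show ?thesis using pos[of k] by (simp add: rrange_rtau x_def del: rtau.simps)
  qed
  \<comment> \<open>The shift by one discards index 0, where the return time is 0 and the quotient
    is a division by zero.\<close>
  ultimately show ?thesis by (subst filterlim_sequentially_Suc[symmetric]) simp
qed

end

section \<open>Locality and independence in a product of copies of a pmf\<close>

locale pmf_product =
  fixes I :: "'i set" and q :: "'a pmf"
  assumes nonempty: "I \<noteq> {}"
begin

definition M :: "('i \<Rightarrow> 'a) measure" where
  "M = PiM I (\<lambda>_. measure_pmf q)"

sublocale prob_space M
  unfolding M_def by (intro prob_space_PiM prob_space_measure_pmf)

lemma measurable_coordinate: "i \<in> I \<Longrightarrow> (\<lambda>\<rho>. \<rho> i) \<in> M \<rightarrow>\<^sub>M count_space UNIV"
  unfolding M_def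
  using measurable_component_singleton[of i I "\<lambda>_. measure_pmf q"] by simp

lemma distr_coordinate: "i \<in> I \<Longrightarrow> distr M (measure_pmf q) (\<lambda>\<rho>. \<rho> i) = measure_pmf q"
  unfolding M_def by (rule distr_PiM_component) (auto intro: prob_space_measure_pmf)

lemma prob_coordinate:
  assumes "i \<in> I"
  shows "prob {\<rho> \<in> space M. P (\<rho> i)} = measure_pmf.prob q {x. P x}"
proof -
  have "measure_pmf.prob q {x. P x} = measure (distr M (measure_pmf q) (\<lambda>\<rho>. \<rho> i)) {x. P x}"
    by (simp add: distr_coordinate assms)
  also have "\<dots> = prob ((\<lambda>\<rho>. \<rho> i) -` {x. P x} \<inter> space M)"
    using measurable_coordinate[OF assms] by (subst measure_distr) auto
  also have "(\<lambda>\<rho>. \<rho> i) -` {x. P x} \<inter> space M = {\<rho> \<in> space M. P (\<rho> i)}" by auto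
  finally show ?thesis by simp
qed

lemma AE_coordinates:
  assumes "countable I" "AE x in measure_pmf q. P x"
  shows "AE \<rho> in M. \<forall>i\<in>I. P (\<rho> i)"
  unfolding M_def using assms
  by (intro AE_ball_countable[THEN iffD2] ballI AE_PiM_component prob_space_measure_pmf) auto

lemma indep_coordinates: "indep_vars (\<lambda>_. measure_pmf q) (\<lambda>i \<rho>. \<rho> i) I"
proof -
  have "distr M (PiM I (\<lambda>_. measure_pmf q)) (\<lambda>\<rho>. restrict \<rho> I) = distr M M (\<lambda>\<rho>. \<rho>)"
    by (rule distr_cong) (auto simp: M_def space_PiM)
  also have "\<dots> = PiM I (\<lambda>i. distr M (measure_pmf q) (\<lambda>\<rho>. \<rho> i))"
    by (simp add: distr_id2 M_def distr_coordinate[unfolded M_def] cong: PiM_cong)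
  finally show ?thesis
    using nonempty measurable_coordinate
    by (subst indep_vars_iff_distr_eq_PiM') auto
qed

text \<open>Restrictions to disjoint blocks of coordinates are independent, and each
  \<open>X j\<close> is a function of its restriction. \<open>ext\<close> fills the coordinates
  outside the block with a fixed value to return to the product space.\<close>

lemma indep_vars_local:
  assumes X: "\<And>j. j \<in> L \<Longrightarrow> X j \<in> M \<rightarrow>\<^sub>M N j"
    and K: "\<And>j. j \<in> L \<Longrightarrow> K j \<subseteq> I" "disjoint_family_on K L"
    and loc: "\<And>j \<rho> \<rho>'. j \<in> L \<Longrightarrow> (\<And>i. i \<in> K j \<Longrightarrow> \<rho> i = \<rho>' i) \<Longrightarrow> X j \<rho> = X j \<rho>'"
  shows "indep_vars N X L"
proof -
  define ext where "ext j \<sigma> = (\<lambda>i\<in>I. if i \<in> K j then \<sigma> i else undefined)" for j and \<sigma> :: "'i \<Rightarrow> 'a"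
  have "indep_vars (\<lambda>j. PiM (K j) (\<lambda>_. measure_pmf q)) (\<lambda>j \<rho>. restrict \<rho> (K j)) L"
    using indep_vars_restrict[OF indep_coordinates K] by simp
  then have "indep_vars N (\<lambda>j \<rho>. X j (ext j (restrict \<rho> (K j)))) L"
  proof (rule indep_vars_compose2)
    fix j assume j: "j \<in> L"
    have "ext j \<in> PiM (K j) (\<lambda>_. measure_pmf q) \<rightarrow>\<^sub>M M"
      unfolding ext_def M_def
    proof (rule measurable_restrict)
      fix i assume "i \<in> I"
      show "(\<lambda>\<sigma>. if i \<in> K j then \<sigma> i else undefined) \<in> PiM (K j) (\<lambda>_. measure_pmf q) \<rightarrow>\<^sub>M measure_pmf q"
        by (cases "i \<in> K j") auto
    qed
    then show "(\<lambda>\<sigma>. X j (ext j \<sigma>)) \<in> PiM (K j) (\<lambda>_. measure_pmf q) \<rightarrow>\<^sub>M N j"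
      using X[OF j] by (rule measurable_compose)
  qed
  moreover have "X j (ext j (restrict \<rho> (K j))) = X j \<rho>" if "j \<in> L" for j \<rho>
    using K(1)[OF that] by (intro loc[OF that]) (auto simp: ext_def)
  ultimately show ?thesis by (simp cong: indep_vars_cong)
qed

text \<open>The case of two events, obtained from a family indexed by the Booleans.\<close>

lemma prob_conj_local:
  assumes [measurable]: "Measurable.pred M P" "Measurable.pred M Q"
    and K: "J \<subseteq> I" "J' \<subseteq> I" "J \<inter> J' = {}"
    and P: "\<And>\<rho> \<rho>'. (\<And>i. i \<in> J \<Longrightarrow> \<rho> i = \<rho>' i) \<Longrightarrow> P \<rho> = P \<rho>'"
    and Q: "\<And>\<rho> \<rho>'. (\<And>i. i \<in> J' \<Longrightarrow> \<rho> i = \<rho>' i) \<Longrightarrow> Q \<rho> = Q \<rho>'"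
  shows "prob {\<rho> \<in> space M. P \<rho> \<and> Q \<rho>} = prob {\<rho> \<in> space M. P \<rho>} * prob {\<rho> \<in> space M. Q \<rho>}"
proof -
  have "indep_vars (\<lambda>_. count_space UNIV) (\<lambda>b. if b then P else Q) UNIV"
  proof (rule indep_vars_local[where K = "\<lambda>b. if b then J else J'"])
    show "(if b then P else Q) \<rho> = (if b then P else Q) \<rho>'"
      if "\<And>i. i \<in> (if b then J else J') \<Longrightarrow> \<rho> i = \<rho>' i" for b \<rho> \<rho>'
      using that P[of \<rho> \<rho>'] Q[of \<rho> \<rho>'] by (cases b) auto
  qed (use K in \<open>auto simp: disjoint_family_on_def\<close>)
  then have "prob (\<Inter>b\<in>UNIV. (if b then P else Q) -` {True} \<inter> space M) =
      (\<Prod>b\<in>UNIV. prob ((if b then P else Q) -` {True} \<inter> space M))"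
    by (rule indep_varsD) auto
  moreover have "(\<Inter>b\<in>UNIV. (if b then P else Q) -` {True} \<inter> space M) = {\<rho> \<in> space M. P \<rho> \<and> Q \<rho>}"
    by (auto simp: UNIV_bool)
  moreover have "R -` {True} \<inter> space M = {\<rho> \<in> space M. R \<rho>}" for R by auto
  ultimately show ?thesis by (simp add: UNIV_bool mult.commute)
qed

text \<open>Relabelling i.i.d. coordinates along an injection preserves their law; this yields the
  self-similarity of the tree.\<close>

lemma prob_reindex:
  assumes f: "inj_on f I" "f \<in> I \<rightarrow> I" and [measurable]: "Measurable.pred M P"
    and loc: "\<And>\<rho> \<rho>'. (\<And>i. i \<in> I \<Longrightarrow> \<rho> i = \<rho>' i) \<Longrightarrow> P \<rho> = P \<rho>'"
  shows "prob {\<rho> \<in> space M. P (\<lambda>i. \<rho> (f i))} = prob {\<rho> \<in> space M. P \<rho>}"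
proof -
  let ?T = "\<lambda>\<rho>. \<lambda>i\<in>I. \<rho> (f i)"
  have T: "?T \<in> M \<rightarrow>\<^sub>M M"
    unfolding M_def using f(2) by (intro measurable_restrict measurable_component_singleton) auto
  have "distr M M ?T = M"
    unfolding M_def using f by (intro distr_PiM_reindex) (auto intro: prob_space_measure_pmf)
  then have "prob {\<rho> \<in> space M. P \<rho>} = measure (distr M M ?T) {\<rho> \<in> space M. P \<rho>}" by simp
  also have "\<dots> = prob (?T -` {\<rho> \<in> space M. P \<rho>} \<inter> space M)"
    by (rule measure_distr[OF T]) measurable
  also have "?T -` {\<rho> \<in> space M. P \<rho>} \<inter> space M = {\<rho> \<in> space M. P (\<lambda>i. \<rho> (f i))}"
  proof -
    have "P (?T \<rho>) = P (\<lambda>i. \<rho> (f i))" for \<rho> by (rule loc) simp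
    then show ?thesis using measurable_space[OF T] by auto
  qed
  finally show ?thesis by simp
qed

end

section \<open>Critical trees\<close>

definition subtree :: "nat \<Rightarrow> nat list \<Rightarrow> nat list set" where
  "subtree d v = {u @ v | u. u \<in> tree_vertices d}"

text \<open>Collects relative words \<open>u\<close> instead of vertices \<open>u @ v\<close>, so
  one bound, the number of words shorter than \<open>N\<close>, serves every
  \<open>v\<close>.\<close>

definition progeny :: "nat \<Rightarrow> nat \<Rightarrow> (nat list \<Rightarrow> nat) \<Rightarrow> nat list \<Rightarrow> nat list set" where
  "progeny d N \<rho> v = {u \<in> tree_vertices d. length u < N \<and> descends d \<rho> v u}"

lemma countable_tree: "countable (tree_vertices d)"
  by (rule countableI_type)

lemma descends_local:
  assumes "\<And>w. w \<in> subtree d v \<Longrightarrow> \<rho> w = \<rho>' w"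
  shows "descends d \<rho> v u = descends d \<rho>' v u"
proof (induction u)
  case (Cons j u)
  show ?case
  proof (cases "descends d \<rho> v u")
    case True
    then have "u \<in> tree_vertices d" by (rule descends_tree)
    then have "\<rho> (u @ v) = \<rho>' (u @ v)" using assms by (auto simp: subtree_def)
    then show ?thesis using Cons by simp
  qed (use Cons in simp)
qed simp

lemma reach_local:
  assumes "\<And>w. w \<in> subtree d v \<Longrightarrow> \<rho> w = \<rho>' w"
  shows "reach d \<rho> v = reach d \<rho>' v"
  unfolding reach_def using descends_local[OF assms] by auto

lemma progeny_local:
  assumes "\<And>w. w \<in> subtree d v \<Longrightarrow> \<rho> w = \<rho>' w"
  shows "progeny d N \<rho> v = progeny d N \<rho>' v"
  unfolding progeny_def using descends_local[OF assms] by auto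

lemma finite_short_words: "finite {u \<in> tree_vertices d. length u < N}"
proof (rule finite_subset)
  show "{u \<in> tree_vertices d. length u < N} \<subseteq> {u. set u \<subseteq> {1..d} \<and> length u \<le> N}"
    by (auto simp: tree_vertices_def)
qed (simp add: finite_lists_length_le)

lemma card_progeny_le: "finite (reach d \<rho> v) \<Longrightarrow> card (progeny d N \<rho> v) \<le> card (reach d \<rho> v)"
  by (rule card_inj_on_le[of "\<lambda>u. u @ v"]) (auto simp: progeny_def reach_def inj_on_def)

section \<open>The critical offspring law\<close>

locale null_recurrent =
  fixes d :: nat and q :: "nat pmf"
  assumes d: "d \<ge> 2"
    and supp: "set_pmf q \<subseteq> {0..d}"
    and mean: "measure_pmf.expectation q real = real d - 1"
    and nondegenerate: "pmf q (d - 1) < 1"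
begin

sublocale pmf_product "tree_vertices d" q
  by unfold_locales (use Nil_tree_vertices in blast)

lemma rotor_config_measure_eq: "rotor_config_measure d q = M"
  by (simp add: rotor_config_measure_def M_def)

text \<open>The probability that the first excursion below a vertex visits its child
  \<open>j\<close>.\<close>

definition open_prob :: "nat \<Rightarrow> real" where
  "open_prob j = measure_pmf.prob q {x. x < j}"

text \<open>Criticality: a rotor at \<open>x\<close> opens \<open>d - x\<close> children, and the
  mean of \<open>x\<close> is \<open>d - 1\<close>.\<close>

lemma sum_open_prob: "(\<Sum>j=1..d. open_prob j) = 1"
proof -
  have fin: "finite (set_pmf q)" using supp finite_subset by blast
  have "(\<Sum>j=1..d. open_prob j) = (\<Sum>j=1..d. measure_pmf.expectation q (\<lambda>x. indicator {x. x < j} x))"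
    by (simp add: open_prob_def)
  also have "\<dots> = measure_pmf.expectation q (\<lambda>x. \<Sum>j=1..d. indicator {x. x < j} x)"
    using fin by (simp add: Bochner_Integration.integral_sum integrable_measure_pmf_finite)
  also have "\<dots> = measure_pmf.expectation q (\<lambda>x. real d - real x)"
  proof (rule integral_cong_AE)
    show "AE x in measure_pmf q. (\<Sum>j=1..d. indicator {x. x < j} x) = real d - real x"
    proof (rule AE_pmfI)
      fix x assume "x \<in> set_pmf q"
      then have "x \<le> d" using supp by auto
      have "(\<Sum>j=1..d. indicator {x. x < j} x) = (\<Sum>j=1..d. if x < j then 1 else (0::real))"
        by (rule sum.cong) (auto simp: indicator_def)
      also have "\<dots> = (\<Sum>j\<in>{j\<in>{1..d}. x < j}. 1)"
        by (rule sum.inter_filter[symmetric]) simp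
      also have "{j\<in>{1..d}. x < j} = {x<..d}" by auto
      finally show "(\<Sum>j=1..d. indicator {x. x < j} x) = real d - real x"
        using \<open>x \<le> d\<close> by (simp add: of_nat_diff)
    qed
  qed auto
  also have "\<dots> = real d - measure_pmf.expectation q real"
    using fin by (simp add: integrable_measure_pmf_finite)
  finally show ?thesis by (simp add: mean)
qed

lemma open_prob_nonneg: "open_prob j \<ge> 0"
  by (simp add: open_prob_def)

text \<open>Since \<open>open_prob\<close> is monotone and sums to 1, its vanishing at
  \<open>d - 1\<close> would force \<open>open_prob d = 1\<close> and thus put all mass of
  \<open>q\<close> on \<open>d - 1\<close>.\<close>

lemma two_children_prob_pos: "open_prob (d - 1) > 0"
proof (rule ccontr)
  assume "\<not> open_prob (d - 1) > 0"
  then have zero: "open_prob (d - 1) = 0" using open_prob_nonneg[of "d - 1"] by simp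
  have "open_prob j = 0" if "j \<le> d - 1" for j
  proof -
    have "open_prob j \<le> open_prob (d - 1)"
      unfolding open_prob_def using that by (intro measure_pmf.finite_measure_mono) auto
    then show ?thesis using zero open_prob_nonneg[of j] by simp
  qed
  moreover have "{1..d} = insert d {1..d - 1}" using d by auto
  ultimately have "open_prob d = 1" using sum_open_prob d by simp
  moreover have "open_prob d = open_prob (d - 1) + pmf q (d - 1)"
  proof -
    have "{x. x < d} = {x. x < d - 1} \<union> {d - 1}" using d by auto
    then have "open_prob d = measure_pmf.prob q ({x. x < d - 1} \<union> {d - 1})"
      by (simp only: open_prob_def)
    also have "\<dots> = open_prob (d - 1) + measure_pmf.prob q {d - 1}"
      unfolding open_prob_def by (rule measure_pmf.finite_measure_Union) auto
    finally show ?thesis by (simp add: measure_pmf_single)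
  qed
  ultimately show False using nondegenerate zero by simp
qed

section \<open>Almost sure extinction of the critical trees\<close>

lemma pred_coordinate: "v \<in> tree_vertices d \<Longrightarrow> Measurable.pred M (\<lambda>\<rho>. P (\<rho> v))"
  using measurable_compose[OF measurable_coordinate[of v], of P "count_space UNIV"] by simp

lemma pred_descends:
  assumes v: "v \<in> tree_vertices d"
  shows "Measurable.pred M (\<lambda>\<rho>. descends d \<rho> v u)"
proof (cases "u \<in> tree_vertices d")
  case True
  then show ?thesis
  proof (induction u)
    case (Cons j u)
    then have [measurable]: "Measurable.pred M (\<lambda>\<rho>. descends d \<rho> v u)" "Measurable.pred M (\<lambda>\<rho>. \<rho> (u @ v) < j)"
      using v by (auto intro: pred_coordinate)
    show ?case by simp
  qed simp
next
  case False
  then have "descends d \<rho> v u = False" for \<rho>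
    using descends_tree by auto
  then show ?thesis by simp
qed

definition immortal :: "nat list \<Rightarrow> (nat list \<Rightarrow> nat) \<Rightarrow> bool" where
  "immortal v \<rho> \<longleftrightarrow> infinite (reach d \<rho> v)"

text \<open>Turns infinitude into countable quantifiers, from which measurability of survival is
  read off.\<close>

lemma infinite_iff_to_nat: "infinite (A :: 'b :: countable set) \<longleftrightarrow> (\<forall>m. \<exists>x. x \<in> A \<and> to_nat x \<ge> m)"
proof -
  have "infinite A \<longleftrightarrow> infinite (to_nat ` A)"
    using finite_image_iff[of to_nat A] inj_on_subset[OF inj_to_nat] by auto
  then show ?thesis by (simp only: infinite_nat_iff_unbounded_le) blast
qed

lemma pred_immortal:
  assumes v: "v \<in> tree_vertices d"
  shows "Measurable.pred M (immortal v)"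
proof -
  note [measurable] = pred_descends[OF v]
  have "immortal v \<rho> \<longleftrightarrow> (\<forall>m. \<exists>w. (\<exists>u. w = u @ v \<and> descends d \<rho> v u) \<and> to_nat w \<ge> m)" for \<rho>
    unfolding immortal_def infinite_iff_to_nat by (simp add: reach_def)
  then show ?thesis by (simp only: cong: measurable_cong) measurable
qed

lemma immortal_local:
  "(\<And>w. w \<in> subtree d v \<Longrightarrow> \<rho> w = \<rho>' w) \<Longrightarrow> immortal v \<rho> = immortal v \<rho>'"
  using reach_local[of d v \<rho> \<rho>'] by (simp add: immortal_def)

lemma immortal_child: "immortal v \<rho> \<Longrightarrow> \<exists>i\<in>{1..d}. \<rho> v < i \<and> immortal (i # v) \<rho>"
  unfolding immortal_def by (subst (asm) reach_unfold) auto

text \<open>The map taking \<open>u\<close> to \<open>u @ v\<close> embeds the whole tree as the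
  subtree of \<open>v\<close>, so survival below \<open>v\<close> is survival at the root for a
  relabelled configuration.\<close>

lemma prob_immortal_eq:
  assumes "v \<in> tree_vertices d"
  shows "prob {\<rho> \<in> space M. immortal v \<rho>} = prob {\<rho> \<in> space M. immortal [] \<rho>}"
proof -
  have "descends d \<rho> v u = descends d (\<lambda>u. \<rho> (u @ v)) [] u" for \<rho> u
    by (induction u) auto
  then have "reach d \<rho> v = (\<lambda>u. u @ v) ` reach d (\<lambda>u. \<rho> (u @ v)) []" for \<rho>
    by (auto simp: reach_def)
  then have "immortal v \<rho> = immortal [] (\<lambda>u. \<rho> (u @ v))" for \<rho>
    by (simp add: immortal_def finite_image_iff inj_on_def)
  moreover have "prob {\<rho> \<in> space M. immortal [] (\<lambda>u. \<rho> (u @ v))} = prob {\<rho> \<in> space M. immortal [] \<rho>}"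
    using assms
    by (intro prob_reindex pred_immortal) (auto simp: inj_on_def subtree_def intro!: immortal_local)
  ultimately show ?thesis by simp
qed

lemma subtree_subset: "v \<in> tree_vertices d \<Longrightarrow> subtree d v \<subseteq> tree_vertices d"
  by (auto simp: subtree_def)

lemma subtree_disjoint: "i \<noteq> j \<Longrightarrow> subtree d (i # v) \<inter> subtree d (j # v) = {}"
  by (auto simp: subtree_def append_Cons_eq_iff)

lemma root_notin_subtree: "v \<notin> subtree d (i # v)"
proof
  assume "v \<in> subtree d (i # v)"
  then obtain u where "v = u @ i # v" by (auto simp: subtree_def)
  then have "length v = length (u @ i # v)" by metis
  then show False by simp
qed

text \<open>With \<open>p\<close> the survival probability, the union bound over the visited children has total
  mass \<open>p\<close>. Counting twice the event that both of the last two children are visited and survive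
  costs at least \<open>open_prob (d - 1) * p\<^sup>2\<close>, which forces \<open>p = 0\<close>.\<close>

lemma prob_immortal_0: "prob {\<rho> \<in> space M. immortal [] \<rho>} = 0"
proof -
  define p where "p = prob {\<rho> \<in> space M. immortal [] \<rho>}"
  define B where "B i = {\<rho> \<in> space M. \<rho> [] < i \<and> immortal [i] \<rho>}" for i
  have B_meas: "B i \<in> events" if "i \<in> {1..d}" for i
  proof -
    have "Measurable.pred M (\<lambda>\<rho>. \<rho> [] < i \<and> immortal [i] \<rho>)"
      using that by (intro pred_intros_logic pred_coordinate pred_immortal) auto
    then show ?thesis by (simp add: B_def pred_def)
  qed
  have B: "prob (B i) = open_prob i * p" if i: "i \<in> {1..d}" for i
  proof -
    have tree: "[i] \<in> tree_vertices d" using i by simp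
    have "prob (B i) = prob {\<rho> \<in> space M. \<rho> [] < i} * prob {\<rho> \<in> space M. immortal [i] \<rho>}"
      unfolding B_def using tree root_notin_subtree[of "[]" i]
      by (intro prob_conj_local[where J = "{[]}" and J' = "subtree d [i]"] subtree_subset)
         (auto intro!: immortal_local pred_coordinate pred_immortal)
    then show ?thesis
      using prob_immortal_eq[OF tree] prob_coordinate[of "[]" "\<lambda>x. x < i"]
      by (simp add: p_def open_prob_def)
  qed
  have both: "prob (B (d - 1) \<inter> B d) = open_prob (d - 1) * p * p"
  proof -
    have tree: "[d - 1] \<in> tree_vertices d" "[d] \<in> tree_vertices d" using d by auto
    \<comment> \<open>\<open>\<rho> [] < d - 1\<close> already implies \<open>\<rho> [] < d\<close>,
      so only survival below \<open>[d]\<close> is left of \<open>B d\<close>, and that reads a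
      separate subtree.\<close>
    have "B (d - 1) \<inter> B d = {\<rho> \<in> space M. (\<rho> [] < d - 1 \<and> immortal [d - 1] \<rho>) \<and> immortal [d] \<rho>}"
      by (auto simp: B_def)
    also have "prob \<dots> = prob (B (d - 1)) * prob {\<rho> \<in> space M. immortal [d] \<rho>}"
      unfolding B_def
    proof (rule prob_conj_local[where J = "insert [] (subtree d [d - 1])" and J' = "subtree d [d]"])
      show "Measurable.pred M (\<lambda>\<rho>. \<rho> [] < d - 1 \<and> immortal [d - 1] \<rho>)"
        using tree by (intro pred_intros_logic pred_coordinate pred_immortal) auto
      show "insert [] (subtree d [d - 1]) \<inter> subtree d [d] = {}"
        using subtree_disjoint[of "d - 1" d "[]"] root_notin_subtree[of "[]"] d by auto
      show "(\<rho> [] < d - 1 \<and> immortal [d - 1] \<rho>) = (\<rho>' [] < d - 1 \<and> immortal [d - 1] \<rho>')"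
        if "\<And>i. i \<in> insert [] (subtree d [d - 1]) \<Longrightarrow> \<rho> i = \<rho>' i" for \<rho> \<rho>'
        using that immortal_local[of "[d - 1]" \<rho> \<rho>'] by auto
      show "insert [] (subtree d [d - 1]) \<subseteq> tree_vertices d" "subtree d [d] \<subseteq> tree_vertices d"
        using subtree_subset[OF tree(1)] subtree_subset[OF tree(2)] by simp_all
    qed (rule pred_immortal[OF tree(2)], rule immortal_local)
    finally show ?thesis
      using B[of "d - 1"] prob_immortal_eq[OF tree(2)] d by (simp add: p_def)
  qed
  have B_last: "B (d - 1) \<in> events" "B d \<in> events"
    using d by (intro B_meas; simp)+
  have B_rest: "B ` {1..<d - 1} \<subseteq> events" using B_meas by auto
  then have B_UN: "(\<Union>i\<in>{1..<d - 1}. B i) \<in> events"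
    by (intro sets.finite_UN) auto
  \<comment> \<open>The last two children get inclusion-exclusion, the others the plain union
    bound.\<close>
  have idx: "{1..d} = insert d (insert (d - 1) {1..<d - 1})" using d by auto
  have "{\<rho> \<in> space M. immortal [] \<rho>} \<subseteq> (B (d - 1) \<union> B d) \<union> (\<Union>i\<in>{1..<d - 1}. B i)"
  proof
    fix \<rho> assume \<rho>: "\<rho> \<in> {\<rho> \<in> space M. immortal [] \<rho>}"
    then obtain i where "i \<in> {1..d}" "\<rho> \<in> B i"
      using immortal_child[of "[]" \<rho>] by (auto simp: B_def)
    then show "\<rho> \<in> (B (d - 1) \<union> B d) \<union> (\<Union>i\<in>{1..<d - 1}. B i)"
      unfolding idx by auto
  qed
  then have "p \<le> prob ((B (d - 1) \<union> B d) \<union> (\<Union>i\<in>{1..<d - 1}. B i))"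
    unfolding p_def using B_last B_UN by (intro finite_measure_mono sets.Un)
  also have "\<dots> \<le> prob (B (d - 1) \<union> B d) + prob (\<Union>i\<in>{1..<d - 1}. B i)"
    using B_last B_UN by (intro measure_Un_le sets.Un)
  also have "prob (\<Union>i\<in>{1..<d - 1}. B i) \<le> (\<Sum>i\<in>{1..<d - 1}. prob (B i))"
    using B_rest by (intro finite_measure_subadditive_finite) simp_all
  also have "prob (B (d - 1) \<union> B d) = prob (B (d - 1)) + prob (B d) - prob (B (d - 1) \<inter> B d)"
    using B_last by (intro measure_Un3) (auto simp: fmeasurable_eq_sets)
  finally have "p \<le> prob (B (d - 1)) + prob (B d) - prob (B (d - 1) \<inter> B d) + (\<Sum>i\<in>{1..<d - 1}. prob (B i))"
    by simp
  also have "\<dots> = (\<Sum>i\<in>{1..d}. prob (B i)) - prob (B (d - 1) \<inter> B d)"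
  proof -
    have "d \<notin> insert (d - 1) {1..<d - 1}" "d - 1 \<notin> {1..<d - 1}" using d by auto
    then have "(\<Sum>i\<in>{1..d}. prob (B i)) = prob (B d) + (prob (B (d - 1)) + (\<Sum>i\<in>{1..<d - 1}. prob (B i)))"
      unfolding idx by (simp only: sum.insert finite_insert finite_atLeastLessThan not_False_eq_True)
    then show ?thesis by simp
  qed
  also have "(\<Sum>i\<in>{1..d}. prob (B i)) = p"
    using B sum_open_prob by (simp add: sum_distrib_right[symmetric])
  finally have "open_prob (d - 1) * p * p \<le> 0"
    unfolding both by simp
  moreover have "p \<ge> 0" by (simp add: p_def)
  ultimately show ?thesis
    using two_children_prob_pos unfolding p_def[symmetric]
    by (smt (verit) mult_pos_pos)
qed

lemma AE_finite_reach: "AE \<rho> in M. \<forall>v\<in>tree_vertices d. finite (reach d \<rho> v)"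
proof -
  have "AE \<rho> in M. finite (reach d \<rho> v)" if "v \<in> tree_vertices d" for v
    using prob_eq_0[OF pred_immortal[OF that, unfolded pred_def]] prob_immortal_eq[OF that] prob_immortal_0
    by (simp add: immortal_def pred_def)
  then show ?thesis
    by (simp add: AE_ball_countable countable_tree)
qed

text \<open>The steps of a path consult rotors at distinct depths, so they are independent and their
  probabilities multiply.\<close>

lemma prob_descends:
  assumes v: "v \<in> tree_vertices d" and u: "u \<in> tree_vertices d"
  shows "prob {\<rho> \<in> space M. descends d \<rho> v u} = prod_list (map open_prob u)"
  using u
proof (induction u)
  case (Cons j u)
  have "prob {\<rho> \<in> space M. descends d \<rho> v u \<and> \<rho> (u @ v) < j}
      = prob {\<rho> \<in> space M. descends d \<rho> v u} * prob {\<rho> \<in> space M. \<rho> (u @ v) < j}"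
  proof (rule prob_conj_local[where J = "{u' @ v | u'. u' \<in> tree_vertices d \<and> length u' < length u}" and J' = "{u @ v}"])
    show "descends d \<rho> v u = descends d \<rho>' v u"
      if "\<And>w. w \<in> {u' @ v | u'. u' \<in> tree_vertices d \<and> length u' < length u} \<Longrightarrow> \<rho> w = \<rho>' w" for \<rho> \<rho>'
    proof -
      have "u \<in> tree_vertices d" using Cons.prems by simp
      then show ?thesis using that
      proof (induction u)
        case (Cons i u)
        then have "\<rho> (u @ v) = \<rho>' (u @ v)" by auto
        moreover have "descends d \<rho> v u = descends d \<rho>' v u" using Cons by (intro Cons.IH) auto
        ultimately show ?case by simp
      qed simp
    qed
  qed (use v Cons.prems in \<open>auto intro: pred_descends pred_coordinate\<close>)
  then show ?case
    using Cons v prob_coordinate[of "u @ v" "\<lambda>x. x < j"] by (simp add: open_prob_def)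
qed (simp add: prob_space)

text \<open>Each generation has mean size 1: the sum expands the \<open>n\<close>-th power of
  \<open>\<Sum>j=1..d. open_prob j\<close>.\<close>

lemma sum_words: "(\<Sum>u | u \<in> tree_vertices d \<and> length u = n. prod_list (map open_prob u)) = 1"
proof (induction n)
  case 0
  have "{u. u \<in> tree_vertices d \<and> length u = 0} = {[]}" by auto
  then show ?case by simp
next
  case (Suc n)
  have "{u. u \<in> tree_vertices d \<and> length u = Suc n} =
      (\<lambda>(j, u). j # u) ` ({1..d} \<times> {u. u \<in> tree_vertices d \<and> length u = n})" (is "_ = ?f ` ?S")
    by (auto simp: length_Suc_conv image_iff)
  then have "(\<Sum>u | u \<in> tree_vertices d \<and> length u = Suc n. prod_list (map open_prob u))
     = (\<Sum>x\<in>?S. prod_list (map open_prob (?f x)))"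
    by (simp only:) (subst sum.reindex, auto simp: inj_on_def)
  also have "\<dots> = (\<Sum>j=1..d. \<Sum>u | u \<in> tree_vertices d \<and> length u = n. open_prob j * prod_list (map open_prob u))"
    by (subst sum.cartesian_product) (auto intro!: sum.cong)
  also have "\<dots> = 1"
    using sum_open_prob by (simp add: sum_distrib_left[symmetric] Suc)
  finally show ?case .
qed

text \<open>Truncating at depth \<open>N\<close> makes the progeny bounded while its mean is exactly \<open>N\<close>.\<close>

definition trunc :: "nat \<Rightarrow> nat list \<Rightarrow> (nat list \<Rightarrow> nat) \<Rightarrow> real" where
  "trunc N v \<rho> = real (card (progeny d N \<rho> v))"

lemma trunc_eq_sum:
  "trunc N v \<rho> = (\<Sum>u | u \<in> tree_vertices d \<and> length u < N. indicator {\<rho>. descends d \<rho> v u} \<rho>)"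
proof -
  have "progeny d N \<rho> v = {u \<in> {u \<in> tree_vertices d. length u < N}. descends d \<rho> v u}"
    by (auto simp: progeny_def)
  then show ?thesis
    using finite_short_words[of d N]
    by (simp add: trunc_def indicator_def sum.If_cases Int_def)
qed

lemma measurable_trunc: "v \<in> tree_vertices d \<Longrightarrow> trunc N v \<in> borel_measurable M"
proof -
  assume v: "v \<in> tree_vertices d"
  note [measurable] = pred_descends[OF v]
  have "(\<lambda>\<rho>. \<Sum>u | u \<in> tree_vertices d \<and> length u < N. of_bool (descends d \<rho> v u) :: real) \<in> borel_measurable M"
    by measurable
  moreover have "trunc N v = (\<lambda>\<rho>. \<Sum>u | u \<in> tree_vertices d \<and> length u < N. of_bool (descends d \<rho> v u))"
    unfolding trunc_eq_sum fun_eq_iff by (simp add: indicator_def)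
  ultimately show ?thesis by simp
qed

lemma expectation_trunc:
  assumes v: "v \<in> tree_vertices d"
  shows "expectation (trunc N v) = N"
proof -
  have sets: "{\<rho> \<in> space M. descends d \<rho> v u} \<in> events" for u
    using pred_descends[OF v] by (simp add: pred_def)
  have "expectation (trunc N v)
     = expectation (\<lambda>\<rho>. \<Sum>u | u \<in> tree_vertices d \<and> length u < N. indicator {\<rho> \<in> space M. descends d \<rho> v u} \<rho>)"
    unfolding trunc_eq_sum by (intro Bochner_Integration.integral_cong sum.cong) (auto simp: indicator_def)
  also have "\<dots> = (\<Sum>u | u \<in> tree_vertices d \<and> length u < N. prob {\<rho> \<in> space M. descends d \<rho> v u})"
    using sets by (subst Bochner_Integration.integral_sum) (auto simp: less_top[symmetric])
  also have "\<dots> = (\<Sum>u | u \<in> tree_vertices d \<and> length u < N. prod_list (map open_prob u))"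
    by (rule sum.cong) (auto simp: prob_descends v)
  also have "\<dots> = (\<Sum>n<N. \<Sum>u | u \<in> tree_vertices d \<and> length u = n. prod_list (map open_prob u))"
  proof -
    have "{u \<in> {u \<in> tree_vertices d. length u < N}. length u = n} = {u. u \<in> tree_vertices d \<and> length u = n}"
      if "n < N" for n
      using that by auto
    then show ?thesis
      using sum.group[of "{u \<in> tree_vertices d. length u < N}" "{..<N}" length "\<lambda>u. prod_list (map open_prob u)"]
        finite_short_words[of d N]
      by (simp add: image_subset_iff)
  qed
  finally show ?thesis by (simp add: sum_words)
qed

end

section \<open>Growth of the range\<close>

text \<open>A conditioning argument: if \<open>Y A\<close> has conditional probability at most
  \<open>c\<close> given each of the disjoint events \<open>X A\<close>, the same bound holds after
  summing over \<open>A\<close>.\<close>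

lemma (in prob_space) prob_UN_inter_le:
  assumes "countable S" and X: "\<And>A. A \<in> S \<Longrightarrow> X A \<in> events" "disjoint_family_on X S"
    and Y: "\<And>A. A \<in> S \<Longrightarrow> Y A \<in> events"
    and le: "\<And>A. A \<in> S \<Longrightarrow> prob (X A \<inter> Y A) \<le> c * prob (X A)" and "c \<ge> 0"
  shows "prob (\<Union>A\<in>S. X A \<inter> Y A) \<le> c"
proof -
  have "emeasure M (\<Union>A\<in>S. X A \<inter> Y A) = (\<integral>\<^sup>+A. emeasure M (X A \<inter> Y A) \<partial>count_space S)"
    using assms(1-4) by (intro emeasure_UN_countable) (auto simp: disjoint_family_on_def)
  also have "\<dots> \<le> (\<integral>\<^sup>+A. ennreal c * emeasure M (X A) \<partial>count_space S)"
    using le \<open>c \<ge> 0\<close>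
    by (intro nn_integral_mono) (auto simp: emeasure_eq_measure ennreal_mult[symmetric])
  also have "\<dots> = ennreal c * emeasure M (\<Union>A\<in>S. X A)"
    using assms(1-3) by (subst emeasure_UN_countable) (auto simp: nn_integral_cmult)
  also have "\<dots> \<le> ennreal c * 1"
    by (intro mult_left_mono) (auto simp: emeasure_le_1)
  finally show ?thesis
    using \<open>c \<ge> 0\<close> by (simp add: emeasure_eq_measure)
qed

context null_recurrent
begin

section \<open>Measurability of the explored set and deviation bounds on its fringe\<close>

lemma pred_toll: "v \<in> tree_vertices d \<Longrightarrow> Measurable.pred M (\<lambda>\<rho>. toll \<rho> v < k)"
proof (induction v arbitrary: k)
  case (Cons j v)
  \<comment> \<open>Only events of the form \<open>toll \<rho> v < k\<close> occur on the right,
    which suits the induction. For \<open>k = 0\<close> the first conjunct already fails, so the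
    truncated \<open>k - 1\<close> is harmless.\<close>
  have "toll \<rho> (j # v) < k \<longleftrightarrow> toll \<rho> v < k \<and> (j \<le> \<rho> v \<longrightarrow> toll \<rho> v < k - 1)" for \<rho>
    by auto
  then show ?case
    using Cons by (simp only:) (intro pred_intros_logic pred_coordinate Cons.IH, auto)
qed simp

lemma pred_explored: "Measurable.pred M (\<lambda>\<rho>. explored d \<rho> k = A)"
proof -
  have "explored d \<rho> k = A \<longleftrightarrow> A \<subseteq> tree_vertices d \<and> (\<forall>v\<in>tree_vertices d. toll \<rho> v < k \<longleftrightarrow> v \<in> A)" for \<rho>
    by (auto simp: explored_def)
  then show ?thesis
    by (simp only:) (intro pred_intros_logic pred_intros_countable_bounded countable_tree pred_toll, auto)
qed

text \<open>The threshold is half the mean. \<open>A\<close> is a fixed set here; the random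
  explored set is inserted only after independence is available.\<close>

definition slow :: "nat \<Rightarrow> nat list set \<Rightarrow> (nat list \<Rightarrow> nat) \<Rightarrow> bool" where
  "slow N A \<rho> \<longleftrightarrow> (\<Sum>v\<in>fringe d A. trunc N v \<rho>) \<le> real N / 2 * card (fringe d A)"

lemma pred_slow: "Measurable.pred M (slow N A)"
proof -
  have [measurable]: "trunc N v \<in> borel_measurable M" if "v \<in> fringe d A" for v
    using that measurable_trunc by (simp add: fringe_def)
  have "(\<lambda>\<rho>. \<Sum>v\<in>fringe d A. trunc N v \<rho>) \<in> borel_measurable M"
    by (intro borel_measurable_sum) measurable
  then show ?thesis unfolding slow_def[abs_def] by measurable
qed

text \<open>Hoeffding's exponent per fringe vertex, for variables bounded by the number of words
  shorter than \<open>N\<close> and a deviation of \<open>N / 2\<close> each.\<close>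

definition rate :: "nat \<Rightarrow> real" where
  "rate N = (real N)\<^sup>2 / (2 * (real (card {u \<in> tree_vertices d. length u < N}))\<^sup>2)"

lemma short_words_pos: "N > 0 \<Longrightarrow> card {u \<in> tree_vertices d. length u < N} > 0"
  using finite_short_words[of d N] by (auto simp: card_gt_0_iff intro!: exI[of _ "[]"])

lemma rate_pos: "N > 0 \<Longrightarrow> rate N > 0"
  using short_words_pos[of N] by (simp add: rate_def)

lemma trunc_local:
  "(\<And>w. w \<in> subtree d v \<Longrightarrow> \<rho> w = \<rho>' w) \<Longrightarrow> trunc N v \<rho> = trunc N v \<rho>'"
  using progeny_local[of d v \<rho> \<rho>' N] by (simp add: trunc_def)

lemma fringe_explored_disjoint:
  "disjoint_family_on (subtree d) (fringe d (explored d \<rho> k))"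
  by (auto simp: disjoint_family_on_def subtree_def dest: fringe_suffix)

text \<open>Hoeffding's inequality for the truncated trees at the fringe. That \<open>A\<close> is a
  possible explored set makes their subtrees disjoint, hence the variables independent; the
  probability itself is unconditional.\<close>

lemma prob_slow:
  assumes "N > 0" and A: "finite A" "A = explored d \<rho> k"
  shows "prob {\<rho> \<in> space M. slow N A \<rho>} \<le> exp (- rate N * card A)"
proof -
  define C where "C = real (card {u \<in> tree_vertices d. length u < N})"
  define n where "n = real (card (fringe d A))"
  have tree: "v \<in> tree_vertices d" if "v \<in> fringe d A" for v
    using that by (simp add: fringe_def)
  have C: "C > 0" using short_words_pos[OF \<open>N > 0\<close>] by (simp add: C_def)
  have An: "real (card A) < n"
    using card_fringe_ge[OF A(1) _ d] A(2) explored_subset_tree by (simp add: n_def)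
  then have n: "n > 0" by linarith
  interpret H: Hoeffding_ineq M "fringe d A" "trunc N" "\<lambda>_. 0" "\<lambda>_. C" "real N * n"
  proof unfold_locales
    show "indep_vars (\<lambda>_. borel) (trunc N) (fringe d A)"
    proof (rule indep_vars_local[where K = "subtree d"])
      show "disjoint_family_on (subtree d) (fringe d A)"
        using fringe_explored_disjoint A(2) by simp
    qed (auto intro: measurable_trunc trunc_local dest: tree subtree_subset)
    have "real N * n = (\<Sum>i\<in>fringe d A. expectation (trunc N i))"
      by (simp add: expectation_trunc tree n_def)
    then show "real N * n \<equiv> (\<Sum>i\<in>fringe d A. expectation (trunc N i))"
      by (rule eq_reflection)
    fix v
    have "trunc N v \<rho> \<le> C" for \<rho>
      unfolding trunc_def C_def of_nat_le_iff
      by (intro card_mono finite_short_words) (auto simp: progeny_def)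
    then show "AE \<rho> in M. trunc N v \<rho> \<in> {0..C}"
      by (auto simp: trunc_def)
  qed (rule finite_fringe[OF A(1)])
  have "prob {\<rho> \<in> space M. slow N A \<rho>} \<le> exp (-2 * (real N * n / 2)\<^sup>2 / (\<Sum>v\<in>fringe d A. (C - 0)\<^sup>2))"
    using H.Hoeffding_ineq_le[of "real N * n / 2"] n C by (simp add: slow_def n_def field_simps)
  also have "-2 * (real N * n / 2)\<^sup>2 / (\<Sum>v\<in>fringe d A. (C - 0)\<^sup>2) = - rate N * n"
    using n C by (simp add: rate_def n_def[symmetric] C_def[symmetric] power2_eq_square field_simps)
  also have "exp (- rate N * n) \<le> exp (- rate N * card A)"
    using An rate_pos[OF \<open>N > 0\<close>] by simp
  finally show ?thesis .
qed

text \<open>The first event reads rotors in \<open>A\<close> by \<open>explored_local\<close>, the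
  second only rotors in the subtrees at the fringe.\<close>

lemma prob_explored_slow:
  assumes A: "A = explored d \<rho>0 k"
  shows "prob {\<rho> \<in> space M. explored d \<rho> k = A \<and> slow N A \<rho>}
       = prob {\<rho> \<in> space M. explored d \<rho> k = A} * prob {\<rho> \<in> space M. slow N A \<rho>}"
proof (rule prob_conj_local[where J = A and J' = "\<Union>v\<in>fringe d A. subtree d v"])
  show "A \<subseteq> tree_vertices d" using A explored_subset_tree by simp
  show "(\<Union>v\<in>fringe d A. subtree d v) \<subseteq> tree_vertices d"
    using subtree_subset by (fastforce simp: fringe_def)
  show "A \<inter> (\<Union>v\<in>fringe d A. subtree d v) = {}"
    using explored_append[of _ _ d \<rho>0 k] A by (auto simp: subtree_def fringe_def)
  show "(explored d \<rho> k = A) = (explored d \<rho>' k = A)" if "\<And>i. i \<in> A \<Longrightarrow> \<rho> i = \<rho>' i" for \<rho> \<rho>'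
    using explored_local[of d \<rho> k \<rho>'] explored_local[of d \<rho>' k \<rho>] that by auto
  show "slow N A \<rho> = slow N A \<rho>'"
    if *: "\<And>i. i \<in> (\<Union>v\<in>fringe d A. subtree d v) \<Longrightarrow> \<rho> i = \<rho>' i" for \<rho> \<rho>'
  proof -
    have "trunc N v \<rho> = trunc N v \<rho>'" if "v \<in> fringe d A" for v
      using * that by (intro trunc_local) auto
    then show ?thesis by (simp add: slow_def)
  qed
qed (rule pred_explored pred_slow)+

text \<open>Finiteness leaves countably many values of the explored set, and the size condition
  turns Hoeffding's bound into a geometric one in \<open>k\<close>. Both conditions hold under
  \<open>finite_excursions\<close>.\<close>

definition bad :: "nat \<Rightarrow> nat \<Rightarrow> (nat list \<Rightarrow> nat) set" where
  "bad N k = {\<rho> \<in> space M. finite (explored d \<rho> k) \<and> k \<le> card (explored d \<rho> k) \<and> slow N (explored d \<rho> k) \<rho>}"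

text \<open>The event is split by the value \<open>A\<close> of the explored set; given each value,
  \<open>slow N A\<close> keeps its unconditional probability.\<close>

lemma bad_prob:
  assumes "N > 0"
  shows "bad N k \<in> events" "prob (bad N k) \<le> exp (- rate N) ^ k"
proof -
  define S where "S = {A. finite A \<and> k \<le> card A \<and> (\<exists>\<rho>. A = explored d \<rho> k)}"
  define X where "X A = {\<rho> \<in> space M. explored d \<rho> k = A}" for A
  define Y where "Y A = {\<rho> \<in> space M. slow N A \<rho>}" for A
  have S: "countable S"
    by (rule countable_subset[OF _ countable_Collect_finite]) (auto simp: S_def)
  have meas: "X A \<in> events" "Y A \<in> events" for A
    using pred_explored pred_slow by (auto simp: X_def Y_def pred_def)
  have eq: "bad N k = (\<Union>A\<in>S. X A \<inter> Y A)"
    by (auto simp: bad_def X_def Y_def S_def)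
  then show "bad N k \<in> events"
    using S meas by (simp add: sets.countable_UN'')
  show "prob (bad N k) \<le> exp (- rate N) ^ k"
    unfolding eq
  proof (rule prob_UN_inter_le)
    show "disjoint_family_on X S" by (auto simp: disjoint_family_on_def X_def)
    fix A assume "A \<in> S"
    then obtain \<rho>0 where A: "finite A" "k \<le> card A" "A = explored d \<rho>0 k" by (auto simp: S_def)
    have "prob (X A \<inter> Y A) = prob {\<rho> \<in> space M. explored d \<rho> k = A \<and> slow N A \<rho>}"
      by (intro arg_cong[where f = prob]) (auto simp: X_def Y_def)
    also have "\<dots> = prob (Y A) * prob (X A)"
      using prob_explored_slow[OF A(3)] by (simp add: X_def Y_def)
    also have "prob (Y A) \<le> exp (- rate N * card A)"
      using prob_slow[OF assms A(1,3)] by (simp add: Y_def)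
    also have "\<dots> \<le> exp (- rate N * k)"
      using A(2) rate_pos[OF assms] by simp
    also have "\<dots> = exp (- rate N) ^ k"
      by (simp add: exp_of_nat_mult[symmetric] mult.commute)
    finally show "prob (X A \<inter> Y A) \<le> exp (- rate N) ^ k * prob (X A)"
      by (simp add: mult_right_mono)
  qed (use S meas in auto)
qed

lemma AE_eventually_not_bad:
  assumes "N > 0"
  shows "AE \<rho> in M. \<forall>\<^sub>F k in sequentially. \<rho> \<notin> bad N k"
proof -
  have "summable (\<lambda>k. prob (bad N k))"
    by (rule summable_comparison_test'[OF summable_geometric[of "exp (- rate N)"]])
       (use bad_prob[OF assms] rate_pos[OF assms] in auto)
  then have "AE \<rho> in M. \<forall>\<^sub>F k in sequentially. \<rho> \<in> space M - bad N k"
    using bad_prob[OF assms] by (intro borel_cantelli_AE1) (auto simp: emeasure_eq_measure)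
  then show ?thesis
    by eventually_elim (auto elim: eventually_mono)
qed

text \<open>Depth \<open>2 * m\<close> gives truncated mean \<open>2 * m\<close>, so exceeding half
  of it yields more than \<open>m\<close> new vertices on average per fringe vertex.\<close>

lemma growth_if_not_bad:
  assumes "finite_excursions d \<rho>" "\<rho> \<in> space M" "\<rho> \<notin> bad (2 * m) k"
  shows "real m * card (explored d \<rho> k) \<le> card (explored d \<rho> (Suc k))"
proof -
  interpret finite_excursions d \<rho> by fact
  have "\<not> slow (2 * m) (E k) \<rho>"
    using assms(2,3) finE card_E_ge by (auto simp: bad_def)
  moreover have "card (E k) \<le> card (fringe d (E k))"
    using card_fringe_ge[OF finE explored_subset_tree d, of k] by simp
  then have "real m * card (E k) \<le> real m * card (fringe d (E k))"
    by (simp add: mult_left_mono)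
  moreover have "trunc (2 * m) v \<rho> \<le> real (card (reach d \<rho> v))" if "v \<in> fringe d (E k)" for v
    using that by (simp add: trunc_def fringe_def card_progeny_le fin_reach)
  then have "(\<Sum>v\<in>fringe d (E k). trunc (2 * m) v \<rho>) \<le> real (\<Sum>v\<in>fringe d (E k). card (reach d \<rho> v))"
    by (simp add: sum_mono)
  ultimately show ?thesis
    using card_explored_Suc[OF finE fin_reach, of k] by (simp add: slow_def)
qed

lemma AE_finite_excursions: "AE \<rho> in M. finite_excursions d \<rho>"
proof -
  have "AE x in measure_pmf q. x \<le> d"
    using supp by (intro AE_pmfI) auto
  from AE_coordinates[OF countable_tree this] AE_finite_reach show ?thesis
    by eventually_elim (unfold_locales, auto simp: d)
qed

lemma AE_ratio_limit:
  "AE \<rho> in M. (\<forall>k. \<exists>n > rtau d \<rho> k. rwalk d \<rho> n = Sink) \<and>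
     (\<lambda>k. real (card (rrange d \<rho> (rtau d \<rho> k))) / real (rtau d \<rho> k)) \<longlonglongrightarrow> 1 / 2"
proof -
  have "AE \<rho> in M. \<forall>m. m > 0 \<longrightarrow> (\<forall>\<^sub>F k in sequentially. \<rho> \<notin> bad (2 * m) k)"
    unfolding AE_all_countable using AE_eventually_not_bad by auto
  with AE_finite_excursions AE_space show ?thesis
  proof eventually_elim
    case (elim \<rho>)
    interpret finite_excursions d \<rho> by fact
    have "\<forall>\<^sub>F k in sequentially. real m * card (E k) \<le> card (E (Suc k))" for m
    \<comment> \<open>The deviation bound needs positive depth \<open>2 * m\<close>; for
      \<open>m = 0\<close> the growth claim is trivial.\<close>
    proof (cases "m = 0")
      case False
      then have "\<forall>\<^sub>F k in sequentially. \<rho> \<notin> bad (2 * m) k" using elim by simp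
      then show ?thesis
        by eventually_elim (use growth_if_not_bad elim in blast)
    qed simp
    then show ?case using return_again ratio_limit by blast
  qed
qed

end

theorem theorem3p3:
  fixes d :: nat and q :: "nat pmf"
  assumes "d \<ge> 2"
    and "set_pmf q \<subseteq> {0..d}"
    and "measure_pmf.expectation q real = real d - 1"
    and "pmf q (d - 1) < 1"
  shows "AE \<rho> in rotor_config_measure d q.
           (\<forall>k. \<exists>n > rtau d \<rho> k. rwalk d \<rho> n = Sink) \<and>
           ((\<lambda>k. real (card (rrange d \<rho> (rtau d \<rho> k))) / real (rtau d \<rho> k))
              \<longlonglongrightarrow> 1 / 2)"
proof -
  interpret null_recurrent d q by unfold_locales (fact assms)+
  show ?thesis unfolding rotor_config_measure_eq by (rule AE_ratio_limit)
qed

end
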